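(* For any $\sigma$-program $P$ with $\mathrm{Lab}_P^{\mathrm{fin}}\neq\emptyset$, the set $\mathrm{Lab}_P^{\mathrm{fin}}$ is $(1,A_1)$-enumerable by a BSS RAM in $\mathsf M_{A_{\mathbb N}}$, where $A_{\mathbb N}=(\mathbb N_+;1;\mathrm{succ};=)$.
   Context: **Programs.** Let $\sigma=(n_1;m_1,\ldots,m_{n_2};k_1,\ldots,k_{n_3})$ be a finite signature with constant symbols $c_i^0$, operation symbols $f_i^{m_i}$, relation symbols $r_i^{k_i}$. A $\sigma$-program $P$ is a list $1:\mathrm{instruction}_1;\ \ldots;\ \ell_P-1:\mathrm{instruction}_{\ell_P-1};\ \ell_P:\text{stop}$ with $\ell_P\ge1$, where each instruction with label $\ell<\ell_P$ has one of the forms: (1) $Z_j:=f_i^{m_i}(Z_{j_1},\ldots,Z_{j_{m_i}})$; (2) $Z_j:=c_i^0$; (3) $Z_{I_j}:=Z_{I_k}$; (4) if $r_i^{k_i}(Z_{j_1},\ldots,Z_{j_{k_i}})$ then goto $\ell_1'$ else goto $\ell_2'$; (5) if $I_j=I_k$ then goto $\ell_1'$ else goto $\ell_2'$; (6) $I_j:=1$; (7) $I_j:=I_j+1$; (11) goto $\ell_1'$ or goto $\ell_2'$; with $\ell_1',\ell_2'\in L_P=\{1,\ldots,\ell_P\}$. Let $L_P^{\circ}=\{1,\ldots,\ell_P-1\}$, $L_P^{\mathrm B}$ = labels of types (4),(5),(11), $L_P^{\mathrm{NB}}=L_P^\circ\setminus L_P^{\mathrm B}$. Put $\beta_P(\ell)=\ell+1$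 for $\ell\in L_P^{\mathrm{NB}}$ and, for $\ell\in L_P^{\mathrm B}$, $\beta_P^+(\ell)=\ell_1'$, $\beta_P^-(\ell)=\ell_2'$. **Finite $P$-paths.** A finite $P$-path of length $s\ge1$ is $(\ell_1,\ldots,\ell_s)\in L_P^s$ with $\ell_1=1$, $\ell_s=\ell_P$, $\ell_t\in L_P^\circ$ for $t<s$, and for all $t<s$: $\ell_{t+1}=\beta_P(\ell_t)$ if $\ell_t\in L_P^{\mathrm{NB}}$, $\ell_{t+1}\in\{\beta_P^+(\ell_t),\beta_P^-(\ell_t)\}$ if $\ell_t\in L_P^{\mathrm B}$. $\mathrm{Lab}_P^{\mathrm{fin}}\subset\mathbb N_+^\infty$ is the set of all finite $P$-paths. **Structure.** $A_{\mathbb N}=(\mathbb N_+;1;\mathrm{succ};=)$ has the positive integers as universe, constant $1$, the unary function $\mathrm{succ}(n)=n+1$, and the identity relation. **Deterministic BSS RAMs.** For a structure $A$ with universe $U_A$ and $U_A^\infty=\bigcup_{n\ge1}U_A^n$, a machine $M\in\mathsf M_A$ is given by a program, that is, a list $1:\mathrm{instruction}_1;\ \ldots;\ q-1:\mathrm{instruction}_{q-1};\ q:\text{stop}$ with $q\ge1$ in which each instruction with label less than $q$ has one of the forms (1) $Z_j:=f_i^{m_i}(Z_{j_1},\ldots,Z_{j_{m_i}})$, (2) $Z_j:=c_i^0$, (3) $Z_{I_j}:=Z_{I_k}$, (4) if $r_i^{k_i}(Z_{j_1},\ldots,Z_{j_{k_i}})$ then goto $q_1$ else goto $q_2$, (5)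 if $I_j=I_k$ then goto $q_1$ else goto $q_2$, (6) $I_j:=1$, (7) $I_j:=I_j+1$, with $q_1,q_2\in\{1,\ldots,q\}$ and with $f_i^{m_i}$, $c_i^0$, $r_i^{k_i}$ operation, constant and relation symbols of the signature of $A$ (interpreted in $A$), and by finitely many index registers $I_1,\ldots,I_{k_M}$ (with values in $\mathbb N_+$) including all those occurring in its program; it has registers $Z_1,Z_2,\ldots$ with values in $U_A$. On input $\vec x\in U_A^n$ it starts at label $1$ with index values $(n,1,\ldots,1)$ and $Z$-values $(x_1,\ldots,x_n,x_n,x_n,\ldots)$. Instructions are executed in the obvious way (type (3) copies the content of $Z_{c(I_k)}$ into $Z_{c(I_j)}$, where $c(\cdot)$ denotes register content; non-branching instructions lead to the next label). When the stop instruction is reached the output is $\mathrm{Res}_M(\vec x)=(c(Z_1),\ldots,c(Z_{c(I_1)}))$. An $A$-machine with input space $\{u\}^\infty=\bigcup_{n\ge1}\{u\}^n$ is defined in the same way but takes only inputs $\vec u^{[n]}=(u,\ldots,u)\in\{u\}^n$, $n\ge1$. **Enumerability.** For $u\in U_A$, a set $N\subseteq U_A^\infty$ is $(u,A_u)$-enumerable by a BSS RAM if there is a machine in $\mathsf M_A$ that first computes $\vec u^{[n]}$ for any input $\vec x\in U_A^n$, $n\ge1$, and then simulates an $A$-machine (with input space $\{u\}^\infty$) computing a surjective function $f:\{u\}^\infty\to N$; thus its result on every $\vec x\in U_A^n$ is $f(\vec u^{[n]})$. Here $A=A_{\mathbb N}$ and $u=1$. *)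

theory Defs
  imports Main "HOL-Library.While_Combinator"
begin

(* All symbols, registers, labels and tuple components are numbered from 1 as in the
   mathematical text, whereas list positions start at 0; hence the "i - 1" in list accesses. *)

record signature =
  num_consts :: nat
  op_arities :: "nat list"
  rel_arities :: "nat list"

record 'a struct =
  sig_of :: signature
  universe :: "'a set"
  const_of :: "nat \<Rightarrow> 'a"
  op_of :: "nat \<Rightarrow> 'a list \<Rightarrow> 'a"
  rel_of :: "nat \<Rightarrow> 'a list \<Rightarrow> bool"


section \<open>Instructions and programs\<close>

datatype instr =
    OpI nat nat "nat list"            (* OpI j i js: Z_j := f_i(Z_j1, ..., Z_jm) *)
  | ConstI nat nat                    (* ConstI j i: Z_j := c_i *)
  | CopyI nat nat                     (* CopyI j k: Z_(I_j) := Z_(I_k) *)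
  | RelI nat "nat list" nat nat       (* RelI i js l1 l2: if r_i(Z_j1, ..., Z_jk) then goto l1 else goto l2 *)
  | IdxEqI nat nat nat nat            (* IdxEqI j k l1 l2: if I_j = I_k then goto l1 else goto l2 *)
  | IdxOneI nat                       (* IdxOneI j: I_j := 1 *)
  | IdxSuccI nat                      (* IdxSuccI j: I_j := I_j + 1 *)

datatype ninstr =
    Det instr
  | Choice nat nat                    (* Choice l1 l2: goto l1 or goto l2 *)

fun wf_instr :: "signature \<Rightarrow> nat \<Rightarrow> instr \<Rightarrow> bool" where
  "wf_instr \<sigma> q (OpI j i js) \<longleftrightarrow>
     1 \<le> j \<and> i \<in> {1..length (op_arities \<sigma>)} \<and>
     length js = op_arities \<sigma> ! (i - 1) \<and> (\<forall>k\<in>set js. 1 \<le> k)"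
| "wf_instr \<sigma> q (ConstI j i) \<longleftrightarrow> 1 \<le> j \<and> i \<in> {1..num_consts \<sigma>}"
| "wf_instr \<sigma> q (CopyI j k) \<longleftrightarrow> 1 \<le> j \<and> 1 \<le> k"
| "wf_instr \<sigma> q (RelI i js l1 l2) \<longleftrightarrow>
     i \<in> {1..length (rel_arities \<sigma>)} \<and>
     length js = rel_arities \<sigma> ! (i - 1) \<and> (\<forall>k\<in>set js. 1 \<le> k) \<and>
     l1 \<in> {1..q} \<and> l2 \<in> {1..q}"
| "wf_instr \<sigma> q (IdxEqI j k l1 l2) \<longleftrightarrow>
     1 \<le> j \<and> 1 \<le> k \<and> l1 \<in> {1..q} \<and> l2 \<in> {1..q}"
| "wf_instr \<sigma> q (IdxOneI j) \<longleftrightarrow> 1 \<le> j"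
| "wf_instr \<sigma> q (IdxSuccI j) \<longleftrightarrow> 1 \<le> j"

fun wf_ninstr :: "signature \<Rightarrow> nat \<Rightarrow> ninstr \<Rightarrow> bool" where
  "wf_ninstr \<sigma> q (Det ins) \<longleftrightarrow> wf_instr \<sigma> q ins"
| "wf_ninstr \<sigma> q (Choice l1 l2) \<longleftrightarrow> l1 \<in> {1..q} \<and> l2 \<in> {1..q}"

(* A program is represented by the list of its instructions other than the final stop
   instruction; the latter is implicit and carries the label stop_label. *)
definition stop_label :: "'i list \<Rightarrow> nat" where
  "stop_label P = length P + 1"

definition instr_at :: "'i list \<Rightarrow> nat \<Rightarrow> 'i" where
  "instr_at P l = P ! (l - 1)"

definition is_program :: "signature \<Rightarrow> ninstr list \<Rightarrow> bool" where
  "is_program \<sigma> P \<longleftrightarrow> (\<forall>ins\<in>set P. wf_ninstr \<sigma> (stop_label P) ins)"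


section \<open>Finite paths\<close>

fun targets :: "ninstr \<Rightarrow> (nat \<times> nat) option" where
  "targets (Det (RelI i js l1 l2)) = Some (l1, l2)"
| "targets (Det (IdxEqI j k l1 l2)) = Some (l1, l2)"
| "targets (Choice l1 l2) = Some (l1, l2)"
| "targets _ = None"

definition labels :: "ninstr list \<Rightarrow> nat set" where
  "labels P = {1..stop_label P}"

definition inner_labels :: "ninstr list \<Rightarrow> nat set" where
  "inner_labels P = {1..<stop_label P}"

definition branch_labels :: "ninstr list \<Rightarrow> nat set" where
  "branch_labels P = {l \<in> inner_labels P. targets (instr_at P l) \<noteq> None}"

definition nonbranch_labels :: "ninstr list \<Rightarrow> nat set" where
  "nonbranch_labels P = inner_labels P - branch_labels P"

definition beta :: "ninstr list \<Rightarrow> nat \<Rightarrow> nat" where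
  "beta P l = l + 1"

definition beta_plus :: "ninstr list \<Rightarrow> nat \<Rightarrow> nat" where
  "beta_plus P l = fst (the (targets (instr_at P l)))"

definition beta_minus :: "ninstr list \<Rightarrow> nat \<Rightarrow> nat" where
  "beta_minus P l = snd (the (targets (instr_at P l)))"

definition finite_path :: "ninstr list \<Rightarrow> nat list \<Rightarrow> bool" where
  "finite_path P ls \<longleftrightarrow>
     ls \<noteq> [] \<and> set ls \<subseteq> labels P \<and> hd ls = 1 \<and> last ls = stop_label P \<and>
     (\<forall>t. Suc t < length ls \<longrightarrow>
        ls ! t \<in> inner_labels P \<and>
        (ls ! t \<in> nonbranch_labels P \<longrightarrow> ls ! Suc t = beta P (ls ! t)) \<and>
        (ls ! t \<in> branch_labels P \<longrightarrow>
           ls ! Suc t \<in> {beta_plus P (ls ! t), beta_minus P (ls ! t)}))"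

definition Lab_fin :: "ninstr list \<Rightarrow> nat list set" where
  "Lab_fin P = {ls. finite_path P ls}"


section \<open>Deterministic BSS RAMs\<close>

record machine =
  prog :: "instr list"
  num_idx :: nat

fun idx_regs :: "instr \<Rightarrow> nat set" where
  "idx_regs (CopyI j k) = {j, k}"
| "idx_regs (IdxEqI j k l1 l2) = {j, k}"
| "idx_regs (IdxOneI j) = {j}"
| "idx_regs (IdxSuccI j) = {j}"
| "idx_regs _ = {}"

(* The first index register always exists: it holds the length of the input and of the output. *)
definition machines :: "'a struct \<Rightarrow> machine set" where
  "machines A = {M. 1 \<le> num_idx M \<and>
     (\<forall>ins\<in>set (prog M). wf_instr (sig_of A) (stop_label (prog M)) ins \<and>
                         idx_regs ins \<subseteq> {1..num_idx M})}"

(* The register functions are only relevant at arguments >= 1. *)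
record 'a config =
  lab :: nat
  idx :: "nat \<Rightarrow> nat"
  zreg :: "nat \<Rightarrow> 'a"

fun exec :: "'a struct \<Rightarrow> instr \<Rightarrow> 'a config \<Rightarrow> 'a config" where
  "exec A (OpI j i js) c =
     c\<lparr>lab := lab c + 1, zreg := (zreg c)(j := op_of A i (map (zreg c) js))\<rparr>"
| "exec A (ConstI j i) c =
     c\<lparr>lab := lab c + 1, zreg := (zreg c)(j := const_of A i)\<rparr>"
| "exec A (CopyI j k) c =
     c\<lparr>lab := lab c + 1, zreg := (zreg c)(idx c j := zreg c (idx c k))\<rparr>"
| "exec A (RelI i js l1 l2) c =
     c\<lparr>lab := (if rel_of A i (map (zreg c) js) then l1 else l2)\<rparr>"
| "exec A (IdxEqI j k l1 l2) c =
     c\<lparr>lab := (if idx c j = idx c k then l1 else l2)\<rparr>"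
| "exec A (IdxOneI j) c =
     c\<lparr>lab := lab c + 1, idx := (idx c)(j := 1)\<rparr>"
| "exec A (IdxSuccI j) c =
     c\<lparr>lab := lab c + 1, idx := (idx c)(j := idx c j + 1)\<rparr>"

definition stopped :: "machine \<Rightarrow> 'a config \<Rightarrow> bool" where
  "stopped M c \<longleftrightarrow> lab c = stop_label (prog M)"

definition step :: "'a struct \<Rightarrow> machine \<Rightarrow> 'a config \<Rightarrow> 'a config" where
  "step A M c = (if stopped M c then c else exec A (instr_at (prog M) (lab c)) c)"

definition initial :: "'a list \<Rightarrow> 'a config" where
  "initial xs = \<lparr>lab = 1,
     idx = (\<lambda>i. if i = 1 then length xs else 1),
     zreg = (\<lambda>j. if j \<le> length xs then xs ! (j - 1) else last xs)\<rparr>"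

definition content :: "'a config \<Rightarrow> 'a list" where
  "content c = map (zreg c) [1..<idx c 1 + 1]"

(* The output of the computation continued from c; None if it does not terminate. *)
definition run :: "'a struct \<Rightarrow> machine \<Rightarrow> 'a config \<Rightarrow> 'a list option" where
  "run A M c = map_option content (while_option (\<lambda>c. \<not> stopped M c) (step A M) c)"

definition Res :: "'a struct \<Rightarrow> machine \<Rightarrow> 'a list \<Rightarrow> 'a list option" where
  "Res A M xs = run A M (initial xs)"

definition reaches :: "'a struct \<Rightarrow> machine \<Rightarrow> 'a config \<Rightarrow> 'a config \<Rightarrow> bool" where
  "reaches A M c d \<longleftrightarrow> (\<exists>t. d = (step A M ^^ t) c)"


section \<open>Enumerability\<close>

definition tuples :: "'a set \<Rightarrow> 'a list set" where
  "tuples U = {xs \<in> lists U. xs \<noteq> []}"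

(* M' is the machine with input space tuples {u} computing the surjection f from tuples {u} onto N,
   M the machine on all inputs. The label p of M is the entry point of its second phase: on an
   input of length n, M first reaches p with the n-tuple (u, ..., u) as its result so far, and
   then goes on to produce the result of M' on that tuple. The clause on Res A M is a consequence
   of the preceding ones. Note that equality of the configuration at p with the initial one
   of M' cannot be demanded, since only finitely many Z-registers can have been overwritten. *)
definition enumerable :: "'a struct \<Rightarrow> 'a \<Rightarrow> 'a list set \<Rightarrow> bool" where
  "enumerable A u N \<longleftrightarrow>
     u \<in> universe A \<and> N \<subseteq> tuples (universe A) \<and>
     (\<exists>f. \<exists>M'\<in>machines A. \<exists>M\<in>machines A. \<exists>p.
        (\<forall>us\<in>tuples {u}. Res A M' us = Some (f us)) \<and>
        f ` tuples {u} = N \<and>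
        (\<forall>xs\<in>tuples (universe A).
           (let us = replicate (length xs) u in
             (\<exists>c. reaches A M (initial xs) c \<and> lab c = p \<and> content c = us \<and>
                  run A M c = Res A M' us) \<and>
             Res A M xs = Some (f us))))"


section \<open>The structure of positive integers with successor\<close>

definition A_N :: "nat struct" where
  "A_N = \<lparr>sig_of = \<lparr>num_consts = 1, op_arities = [1], rel_arities = [2]\<rparr>,
          universe = {n. 1 \<le> n},
          const_of = (\<lambda>i. 1),
          op_of = (\<lambda>i xs. xs ! 0 + 1),
          rel_of = (\<lambda>i xs. xs ! 0 = xs ! 1)\<rparr>"

end

theory Submission imports Defs begin

text \<open>
  The input length \<open>n\<close> is read as a sequence of binary choices, namely its binary digits without
  the leading one, least significant first. The machine follows the program from label \<open>1\<close>,
  resolving every step by one digit, and outputs the labels visited if the stop label is reached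
  before the digits run out, and a fixed finite path otherwise. All arithmetic is done in index
  registers. \<open>Z\<^sub>1\<close> serves as scratch register for the label to be written: this is
  harmless because every path starts with \<open>1\<close>, so that \<open>Z\<^sub>1\<close> can be restored at the end.
  As this machine overwrites its input by ones before anything else and never reads an uninitialised
  register, it can play both roles in the definition of enumerability.
\<close>

section \<open>Execution of code fragments\<close>

abbreviation conf :: "nat \<Rightarrow> (nat \<Rightarrow> nat) \<Rightarrow> (nat \<Rightarrow> 'a) \<Rightarrow> 'a config" where
  "conf l f z \<equiv> \<lparr>lab = l, idx = f, zreg = z\<rparr>"

text \<open>No instruction jumps unconditionally, but a test of \<open>I_1\<close> against itself
  always succeeds.\<close>

abbreviation goto :: "nat \<Rightarrow> instr" where
  "goto l \<equiv> IdxEqI 1 1 l l"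

definition code_at :: "'i list \<Rightarrow> nat \<Rightarrow> 'i list \<Rightarrow> bool" where
  "code_at p a is \<longleftrightarrow> (\<exists>pre post. p = pre @ is @ post \<and> a = Suc (length pre))"

lemma code_atI: "p = pre @ is @ post \<Longrightarrow> a = Suc (length pre) \<Longrightarrow> code_at p a is"
  unfolding code_at_def by blast

lemma code_at_append:
  assumes "code_at p a (xs @ ys)"
  shows "code_at p a xs" "code_at p (a + length xs) ys"
proof -
  from assms obtain pre post where p: "p = pre @ xs @ ys @ post" "a = Suc (length pre)"
    unfolding code_at_def by auto
  then show "code_at p a xs" by (intro code_atI[of _ pre]) auto
  from p show "code_at p (a + length xs) ys" by (intro code_atI[of _ "pre @ xs"]) auto
qed

lemma code_at_Cons:
  assumes "code_at p a (x # xs)"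
  shows "instr_at p a = x" "a \<noteq> stop_label p" "code_at p (Suc a) xs"
proof -
  from assms obtain pre post where p: "p = pre @ x # xs @ post" "a = Suc (length pre)"
    unfolding code_at_def by auto
  then show "instr_at p a = x" "a \<noteq> stop_label p"
    by (auto simp: instr_at_def stop_label_def)
  from p show "code_at p (Suc a) xs" by (intro code_atI[of _ "pre @ [x]"]) auto
qed

lemma reaches_refl: "reaches A M c c"
  unfolding reaches_def by (rule exI[of _ 0]) simp

lemma reaches_trans [trans]:
  assumes "reaches A M c d" "reaches A M d e" shows "reaches A M c e"
proof -
  from assms obtain s t where "d = (step A M ^^ s) c" "e = (step A M ^^ t) d"
    unfolding reaches_def by blast
  then have "e = (step A M ^^ (t + s)) c" by (simp add: funpow_add)
  then show ?thesis unfolding reaches_def by blast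
qed

lemma reaches_step:
  assumes "reaches A M (step A M c) d" shows "reaches A M c d"
proof -
  obtain t where "d = (step A M ^^ t) (step A M c)" using assms unfolding reaches_def by blast
  then have "d = (step A M ^^ Suc t) c" by (simp only: funpow_Suc_right o_apply)
  then show ?thesis unfolding reaches_def by blast
qed

lemma reaches_exec:
  assumes "instr_at (prog M) (lab c) = i" "lab c \<noteq> stop_label (prog M)"
    and "reaches A M (exec A i c) d"
  shows "reaches A M c d"
  by (rule reaches_step) (use assms in \<open>simp add: step_def stopped_def\<close>)

text \<open>\<open>while_option\<close> halts at the first stopped configuration, whereas the number
  of steps behind \<open>reaches\<close> may be larger. The surplus is harmless because
  \<open>step\<close> fixes stopped configurations.\<close>

lemma run_reaches:
  assumes "reaches A M c d" "stopped M d"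
  shows "run A M c = Some (content d)"
proof -
  have "while_option (\<lambda>c. \<not> stopped M c) (step A M) c = Some ((step A M ^^ t) c)"
    if "stopped M ((step A M ^^ t) c)" for t
    using that
  proof (induction t arbitrary: c)
    case 0
    then show ?case by (subst while_option_unfold) simp
  next
    case (Suc t)
    have IH: "while_option (\<lambda>c. \<not> stopped M c) (step A M) (step A M c)
        = Some ((step A M ^^ t) (step A M c))"
      using Suc.prems by (intro Suc.IH) (simp add: funpow_swap1)
    show ?case
    proof (cases "stopped M c")
      case True
      then have stuck: "step A M c = c" by (simp add: step_def)
      then have "(step A M ^^ k) c = c" for k by (induction k) auto
      then show ?thesis using IH stuck by simp
    next
      case False
      then show ?thesis using IH by (subst while_option_unfold) (simp add: funpow_swap1)
    qed
  qed
  note halts = this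
  obtain t where "d = (step A M ^^ t) c" using assms(1) unfolding reaches_def by blast
  then show ?thesis using halts[of t] assms(2) by (simp add: run_def)
qed

lemma code_at_nth:
  assumes "code_at p a is" "n < length is"
  shows "instr_at p (a + n) = is ! n" "a + n \<noteq> stop_label p"
  using assms by (auto simp: code_at_def instr_at_def stop_label_def nth_append)

lemma reaches_code:
  assumes "code_at (prog M) a is" "l = a + n" "n < length is" "exec A (is ! n) (conf l f z) = d"
  shows "reaches A M (conf l f z) d"
proof (rule reaches_exec)
  show "instr_at (prog M) (lab (conf l f z)) = is ! n" "lab (conf l f z) \<noteq> stop_label (prog M)"
    using code_at_nth[OF assms(1,3)] assms(2) by simp_all
  show "reaches A M (exec A (is ! n) (conf l f z)) d"
    unfolding assms(4) by (rule reaches_refl)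
qed

text \<open>Every non-branching instruction moves on to the next label, so such code is evaluated by
  folding \<open>exec\<close>. This handles the fragments whose length depends on \<open>q\<close>
  or \<open>D\<close>.\<close>

lemma reaches_straight:
  assumes "code_at (prog M) (lab c) is" "\<forall>i\<in>set is. targets (Det i) = None"
  shows "reaches A M c (fold (exec A) is c)"
  using assms
proof (induction "is" arbitrary: c)
  case Nil
  then show ?case by (simp add: reaches_refl)
next
  case (Cons i "is")
  note code = code_at_Cons[OF Cons.prems(1)]
  have "lab (exec A i c) = Suc (lab c)" using Cons.prems(2) by (cases i) auto
  then have "reaches A M (exec A i c) (fold (exec A) is (exec A i c))"
    using Cons code by (intro Cons.IH) auto
  with code show ?case by (auto intro: reaches_exec[of M c i])
qed

text \<open>Index registers can only be reset, incremented and compared, so copying means counting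
  up from 1 until they agree. Jump targets are absolute, hence the parameter \<open>a\<close> for
  the address of the fragment; \<open>t\<close> is the exit.\<close>

definition copy_idx :: "nat \<Rightarrow> nat \<Rightarrow> nat \<Rightarrow> nat \<Rightarrow> instr list" where
  "copy_idx i j a t = [IdxOneI i, IdxEqI i j t (a + 2), IdxSuccI i, goto (a + 1)]"

lemma length_copy_idx [simp]: "length (copy_idx i j a t) = 4"
  by (simp add: copy_idx_def)

lemma reaches_copy_idx:
  assumes code: "code_at (prog M) a (copy_idx i j a t)" and "i \<noteq> j" "1 \<le> f j"
  shows "reaches A M (conf a f z) (conf t (f(i := f j)) z)"
proof -
  note at = reaches_code[OF code]
  \<comment> \<open>Register \<open>i\<close> approaches register \<open>j\<close> from below;
    \<open>1 \<le> f j\<close> ensures that the reset value 1 does not overshoot.\<close>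
  have loop: "reaches A M (conf (a + 1) g z) (conf t (g(i := g j)) z)" if "g i \<le> g j" for g
    using that
  proof (induction "g j - g i" arbitrary: g)
    case 0
    then have "g(i := g j) = g" "g i = g j" by auto
    then show ?case by (intro at[where n = 1]) (simp_all add: copy_idx_def)
  next
    case (Suc n)
    let ?g = "g(i := g i + 1)"
    have "reaches A M (conf (a + 1) g z) (conf (a + 2) g z)"
      using Suc(2) by (intro at[where n = 1]) (auto simp: copy_idx_def)
    also have "reaches A M (conf (a + 2) g z) (conf (a + 3) ?g z)"
      by (rule at[where n = 2]) (simp_all add: copy_idx_def)
    also have "reaches A M (conf (a + 3) ?g z) (conf (a + 1) ?g z)"
      by (rule at[where n = 3]) (simp_all add: copy_idx_def)
    also have "reaches A M (conf (a + 1) ?g z) (conf t (?g(i := ?g j)) z)"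
      using Suc assms(2) by (intro Suc.hyps(1)) auto
    finally show ?case using assms(2) by simp
  qed
  have "reaches A M (conf a f z) (conf (a + 1) (f(i := 1)) z)"
    by (rule at[where n = 0]) (simp_all add: copy_idx_def)
  also have "reaches A M (conf (a + 1) (f(i := 1)) z) (conf t (f(i := f j)) z)"
    using loop[of "f(i := 1)"] assms(2,3) by simp
  finally show ?thesis .
qed

definition load :: "nat \<Rightarrow> nat \<Rightarrow> instr list" where
  "load j v = ConstI j 1 # replicate (v - 1) (OpI j 1 [j])"

lemma length_load [simp]: "1 \<le> v \<Longrightarrow> length (load j v) = v"
  by (simp add: load_def)

lemma funpow_exec_ConstI:
  "(exec A_N (ConstI j (Suc 0)) ^^ k) (conf a f z) =
     conf (a + k) f (if k = 0 then z else z(j := 1))"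
  by (induction k arbitrary: a z) (auto simp: A_N_def)

lemma funpow_exec_OpI:
  "(exec A_N (OpI j (Suc 0) [j]) ^^ k) (conf a f z) = conf (a + k) f (z(j := z j + k))"
  by (induction k arbitrary: a z) (auto simp: A_N_def)

lemma funpow_exec_IdxSuccI:
  "(exec A (IdxSuccI j) ^^ k) (conf a f z) = conf (a + k) (f(j := f j + k)) z"
  by (induction k arbitrary: a f) auto

lemma fold_exec_load:
  assumes "1 \<le> v"
  shows "fold (exec A_N) (load j v) (conf a f z) = conf (a + v) f (z(j := v))"
proof -
  have "exec A_N (ConstI j 1) (conf a f z) = conf (a + 1) f (z(j := 1))" by (simp add: A_N_def)
  with assms show ?thesis by (simp add: load_def funpow_exec_OpI)
qed

definition output_const :: "nat list \<Rightarrow> instr list" where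
  "output_const D = IdxOneI 1 # replicate (length D - 1) (IdxSuccI 1) @
     concat (map (\<lambda>j. load (Suc j) (D ! j)) [0..<length D])"

text \<open>Loading a later cell leaves the earlier ones intact. The final label \<open>b\<close> is
  left open; \<open>lab_fold_exec\<close> supplies it from the length of the code.\<close>

lemma fold_exec_loads:
  assumes "\<forall>v\<in>set D. 1 \<le> v" "k \<le> length D"
  shows "\<exists>b z'. fold (exec A_N) (concat (map (\<lambda>j. load (Suc j) (D ! j)) [0..<k])) (conf a f z) = conf b f z'
     \<and> (\<forall>j<k. z' (Suc j) = D ! j)"
  using assms(2)
proof (induction k)
  case 0
  then show ?case by simp
next
  case (Suc k)
  have "1 \<le> D ! k" using Suc.prems assms(1) by simp
  moreover obtain b z' where
    "fold (exec A_N) (concat (map (\<lambda>j. load (Suc j) (D ! j)) [0..<k])) (conf a f z) = conf b f z'"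
    "\<forall>j<k. z' (Suc j) = D ! j"
    using Suc by auto
  ultimately show ?case by (auto simp: fold_exec_load less_Suc_eq)
qed

lemma lab_fold_exec:
  "\<forall>i\<in>set is. targets (Det i) = None \<Longrightarrow> lab (fold (exec A) is c) = lab c + length is"
proof (induction "is" arbitrary: c)
  case (Cons i "is")
  have "lab (exec A i c) = Suc (lab c)" using Cons.prems by (cases i) auto
  with Cons show ?case by simp
qed simp

lemma straight_output_const: "i \<in> set (output_const D) \<Longrightarrow> targets (Det i) = None"
  by (auto simp: output_const_def load_def)

lemma reaches_output_const:
  assumes "code_at (prog M) a (output_const D)" "D \<noteq> []" "\<forall>v\<in>set D. 1 \<le> v"
  shows "\<exists>d. reaches A_N M (conf a f z) d \<and> lab d = a + length (output_const D) \<and> content d = D"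
proof (intro exI conjI)
  let ?d = "fold (exec A_N) (output_const D) (conf a f z)"
  show "reaches A_N M (conf a f z) ?d"
    using assms(1) by (intro reaches_straight) (auto dest: straight_output_const)
  show "lab ?d = a + length (output_const D)"
    by (subst lab_fold_exec) (auto dest: straight_output_const)
  obtain b z' where "?d = conf b (f(1 := length D)) z'" "\<forall>j<length D. z' (Suc j) = D ! j"
    using fold_exec_loads[OF assms(3), of "length D" "a + 1 + (length D - 1)" "f(1 := length D)" z] assms(2)
    by (auto simp: output_const_def funpow_exec_IdxSuccI)
  then show "content ?d = D"
    by (auto simp: content_def intro!: nth_equalityI simp del: upt_Suc)
qed

section \<open>Walks steered by binary digits\<close>

text \<open>Of a program only the stop label \<open>q\<close> and the two possible successors of
  each inner label are kept. \<open>D\<close> is the fallback output; that it is itself a path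
  enters only in \<open>enumerable_paths\<close>.\<close>

locale walk_machine =
  fixes q :: nat and s0 s1 :: "nat \<Rightarrow> nat" and D :: "nat list"
  assumes q: "1 \<le> q"
    and s0: "1 \<le> l \<Longrightarrow> l < q \<Longrightarrow> s0 l \<in> {1..q}"
    and s1: "1 \<le> l \<Longrightarrow> l < q \<Longrightarrow> s1 l \<in> {1..q}"
    and D: "D \<noteq> []" "\<forall>v\<in>set D. 1 \<le> v"
begin

definition nxt :: "nat \<Rightarrow> nat \<Rightarrow> nat" where
  "nxt l m = (if even m then s0 l else s1 l)"

text \<open>\<open>m = 1\<close> is the bare leading digit, with no choices left. Counting
  \<open>m = 0\<close> as failure too makes \<open>m\<close> decrease in every recursive call.
  Digits left over at \<open>q\<close> are ignored.\<close>

fun walk :: "nat \<Rightarrow> nat \<Rightarrow> nat list option" where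
  "walk l m = (if l = q then Some [q] else if m \<le> 1 then None
     else map_option ((#) l) (walk (nxt l m) (m div 2)))"

declare walk.simps [simp del]

lemma walk_simps [simp]:
  "walk q m = Some [q]"
  "l \<noteq> q \<Longrightarrow> m \<le> 1 \<Longrightarrow> walk l m = None"
  "l \<noteq> q \<Longrightarrow> 1 < m \<Longrightarrow> walk l m = map_option ((#) l) (walk (nxt l m) (m div 2))"
  by (subst walk.simps; simp)+

text \<open>Every entry with a successor is below \<open>q\<close>, so \<open>q\<close> occurs only
  at the end. The start \<open>l\<close> is arbitrary so that the inductions can pass to
  tails.\<close>

definition path_from :: "nat \<Rightarrow> nat list \<Rightarrow> bool" where
  "path_from l ls \<longleftrightarrow> ls \<noteq> [] \<and> set ls \<subseteq> {1..q} \<and> hd ls = l \<and> last ls = q \<and>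
     successively (\<lambda>a b. a \<in> {1..<q} \<and> b \<in> {s0 a, s1 a}) ls"

lemma nxt: "1 \<le> l \<Longrightarrow> l < q \<Longrightarrow> nxt l m \<in> {1..q}"
  using s0 s1 by (simp add: nxt_def)

lemma walk_path_from:
  "walk l m = Some ls \<Longrightarrow> l \<in> {1..q} \<Longrightarrow> path_from l ls"
proof (induction l m arbitrary: ls rule: walk.induct)
  case (1 l m)
  show ?case
  proof (cases "l = q")
    case True
    then show ?thesis using 1(2) q by (auto simp: path_from_def)
  next
    case False
    moreover from this 1(2) have "\<not> m \<le> 1" by (cases "m \<le> 1") auto
    ultimately obtain ls' where ls: "\<not> m \<le> 1" "walk (nxt l m) (m div 2) = Some ls'" "ls = l # ls'"
      using 1(2) by auto
    have "path_from (nxt l m) ls'" using 1(1)[OF False ls(1,2)] nxt[of l m] 1(3) False by auto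
    then show ?thesis using 1(3) False ls(3)
      by (cases ls') (auto simp: path_from_def nxt_def)
  qed
qed

text \<open>The number is built from the end of the path: 1 serves for \<open>[q]\<close>, and
  doubling, plus one for an \<open>s1\<close> step, puts a new lowest digit in front.
  \<open>1 \<le> m\<close> keeps the result above 1, so that this digit is really read.\<close>

lemma path_from_walk:
  "path_from l ls \<Longrightarrow> \<exists>m\<ge>1. walk l m = Some ls"
proof (induction ls arbitrary: l)
  case Nil
  then show ?case by (simp add: path_from_def)
next
  case (Cons a ls)
  show ?case
  proof (cases ls)
    case Nil
    then show ?thesis using Cons.prems by (intro exI[of _ 1]) (auto simp: path_from_def)
  next
    case (Cons b ls')
    have l: "path_from b ls" "l = a" "a \<in> {1..<q}" "b = s0 a \<or> b = s1 a"
      using Cons.prems Cons by (auto simp: path_from_def)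
    obtain m where m: "1 \<le> m" "walk b m = Some ls" using Cons.IH[OF l(1)] by blast
    from l(4) show ?thesis
    proof
      assume "b = s0 a"
      then have "walk l (2 * m) = Some (a # ls)" using l m by (simp add: nxt_def)
      then show ?thesis using m(1) by (intro exI[of _ "2 * m"]) simp
    next
      assume "b = s1 a"
      then have "walk l (2 * m + 1) = Some (a # ls)" using l m by (simp add: nxt_def)
      then show ?thesis by (intro exI[of _ "2 * m + 1"]) simp
    qed
  qed
qed

section \<open>The enumerating machine\<close>

text \<open>\<open>I\<^sub>1\<close> holds the digits still to be read, \<open>I\<^sub>2\<close> the next output position,
  \<open>I\<^sub>3\<close> always has the value \<open>1\<close>, and \<open>I\<^sub>4\<close>, \<open>I\<^sub>5\<close> are used for halving \<open>I\<^sub>1\<close>.\<close>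

text \<open>The superfluous assignments make the length of the code independent of \<open>l\<close>.\<close>
definition emit :: "nat \<Rightarrow> instr list" where
  "emit l = replicate (q - l) (ConstI 1 1) @ load 1 l @ [CopyI 2 3]"

text \<open>\<open>q + 1\<close> instructions for \<open>emit\<close>, 2 for the increment and the
  test, 16 for \<open>halve\<close>.\<close>

definition block_size :: nat where
  "block_size = q + 19"

text \<open>The prologue occupies labels 1 to 6. For \<open>l = q\<close> this is the address of
  \<open>final\<close>, so jumps to a successor need no case distinction.\<close>

definition addr :: "nat \<Rightarrow> nat" where
  "addr l = 7 + (l - 1) * block_size"

definition fail_label :: nat where
  "fail_label = addr q + q + 6"

definition end_label :: nat where
  "end_label = fail_label + length (output_const D)"

text \<open>\<open>I_4\<close> counts up to \<open>I_1\<close> while \<open>I_5\<close> advances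
  half as fast, ending at the rounded-down half. Which of the two tests succeeds reveals the parity,
  so the copy back to \<open>I_1\<close> exists once per exit.\<close>

definition halve :: "nat \<Rightarrow> nat \<Rightarrow> nat \<Rightarrow> instr list" where
  "halve k t0 t1 = [IdxOneI 4, IdxOneI 5, IdxSuccI 4, IdxEqI 4 1 (k + 8) (k + 4),
     IdxSuccI 4, IdxEqI 4 1 (k + 12) (k + 6), IdxSuccI 5, goto (k + 2)] @
     copy_idx 1 5 (k + 8) t0 @ copy_idx 1 5 (k + 12) t1"

text \<open>Comparison with \<open>I_3 = 1\<close> detects that only the leading digit is left. What
  has been written by then does no harm, since \<open>output_const D\<close> sets every cell of its
  output.\<close>

definition block :: "nat \<Rightarrow> instr list" where
  "block l = emit l @ [IdxSuccI 2, IdxEqI 1 3 fail_label (addr l + q + 3)] @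
     halve (addr l + q + 3) (addr (s0 l)) (addr (s1 l))"

text \<open>\<open>I_2\<close> is not advanced after the last entry, so it equals the length of the
  path. \<open>ConstI 1 1\<close> restores the first entry.\<close>

definition final :: "instr list" where
  "final = emit q @ [ConstI 1 1] @ copy_idx 1 2 (addr q + q + 2) end_label"

text \<open>\<open>I_2\<close> runs from 1 to \<open>I_1\<close> while the 1 in \<open>Z_1\<close>
  is copied through \<open>I_3\<close>. Label 6 is the entry to the second phase, to which the reset
  of \<open>I_2\<close> already belongs.\<close>

definition prologue :: "instr list" where
  "prologue = [ConstI 1 1, CopyI 2 3, IdxEqI 2 1 6 4, IdxSuccI 2, goto 2, IdxOneI 2]"

definition M :: machine where
  "M = \<lparr>prog = prologue @ concat (map block [1..<q]) @ final @ output_const D, num_idx = 5\<rparr>"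

section \<open>Layout of the code and well-formedness of the machine\<close>

lemma length_emit: "l \<in> {1..q} \<Longrightarrow> length (emit l) = q + 1"
  by (simp add: emit_def)

lemma length_block: "l \<in> {1..q} \<Longrightarrow> length (block l) = block_size"
  by (simp add: block_def length_emit halve_def block_size_def)

lemma length_blocks: "l \<le> q \<Longrightarrow> length (concat (map block [Suc 0..<l])) = (l - 1) * block_size"
proof (induction l)
  case (Suc l)
  then show ?case by (cases l) (auto simp: length_block)
qed simp

lemma stop_label_M: "stop_label (prog M) = end_label"
  using q by (simp add: M_def stop_label_def prologue_def length_blocks final_def length_emit
      end_label_def fail_label_def addr_def)

lemma code_at_prologue: "code_at (prog M) 1 prologue"
  by (rule code_atI[of _ "[]"]) (auto simp: M_def)

lemma code_at_block:
  assumes "l \<in> {1..<q}" shows "code_at (prog M) (addr l) (block l)"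
proof (rule code_atI)
  have "[1..<q] = [1..<l] @ l # [Suc l..<q]"
    using assms upt_add_eq_append[of 1 l "q - l"] by (simp add: upt_conv_Cons)
  then show "prog M = (prologue @ concat (map block [1..<l])) @ block l @
      (concat (map block [Suc l..<q]) @ final @ output_const D)"
    by (simp add: M_def)
  show "addr l = Suc (length (prologue @ concat (map block [1..<l])))"
    using assms length_blocks[of l] by (simp add: addr_def prologue_def)
qed

lemma code_at_final: "code_at (prog M) (addr q) final"
  by (rule code_atI[of _ "prologue @ concat (map block [1..<q])"])
    (simp_all add: M_def addr_def prologue_def length_blocks)

lemma code_at_fail: "code_at (prog M) fail_label (output_const D)"
  using q by (intro code_atI[of _ "prologue @ concat (map block [1..<q]) @ final" _ "[]"])
    (simp_all add: M_def addr_def prologue_def length_blocks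
     fail_label_def final_def length_emit)

lemma addr_le: assumes "l \<in> {1..q}" shows "1 \<le> addr l" "addr l \<le> addr q" "addr l \<le> end_label"
  "addr q \<le> fail_label" "fail_label \<le> end_label"
proof -
  show "addr l \<le> addr q" using assms by (auto simp: addr_def intro!: mult_le_mono1)
  then show "addr l \<le> end_label" "addr q \<le> fail_label" "fail_label \<le> end_label"
    by (auto simp: end_label_def fail_label_def)
  show "1 \<le> addr l" by (simp add: addr_def)
qed

lemma addr_Suc_le:
  assumes "l \<in> {1..<q}" shows "addr l + q + 19 \<le> end_label"
proof -
  have "addr l + block_size = addr (Suc l)" using assms by (cases l) (auto simp: addr_def)
  also have "\<dots> \<le> end_label" using assms by (intro addr_le) auto
  finally show ?thesis by (simp add: block_size_def)
qed

lemma M_in_machines: "M \<in> machines A_N"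
proof -
  define ok where "ok ins \<longleftrightarrow> wf_instr (sig_of A_N) end_label ins \<and> idx_regs ins \<subseteq> {1..5}" for ins
  have load: "ok ins" if "ins \<in> set (load j v)" "1 \<le> j" for ins j v
    using that by (auto simp: load_def ok_def A_N_def)
  have emit: "ok ins" if "ins \<in> set (emit l)" for ins l
    using that load[of ins 1] by (auto simp: emit_def) (auto simp: ok_def A_N_def)
  have copy: "ok ins" if "ins \<in> set (copy_idx 1 j a t)" "j \<in> {1..5}" "a + 2 \<le> end_label"
      "t \<in> {1..end_label}" for ins j a t
    using that by (auto simp: copy_idx_def ok_def)
  have "ok ins" if "ins \<in> set prologue" for ins
    using that by (auto simp: prologue_def ok_def A_N_def end_label_def fail_label_def addr_def)
  moreover have "ok ins" if ins: "ins \<in> set (block l)" and l: "l \<in> {1..<q}" for ins l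
  proof -
    define a where "a = addr l + q + 3"
    have a: "1 \<le> a" "a + 16 \<le> end_label" using addr_Suc_le[OF l] by (simp_all add: a_def)
    have s: "addr (s0 l) \<in> {1..end_label}" "addr (s1 l) \<in> {1..end_label}"
      using addr_le[of "s0 l"] addr_le[of "s1 l"] s0[of l] s1[of l] l by auto
    have f: "fail_label \<in> {1..end_label}" using addr_le[of l] l by auto
    show ?thesis
      using ins emit[of ins l] copy[of ins 5 "a + 8" "addr (s0 l)"] copy[of ins 5 "a + 12" "addr (s1 l)"]
        a s f
      unfolding block_def halve_def a_def[symmetric] by (auto simp: ok_def)
  qed
  moreover have "ok ins" if ins: "ins \<in> set final" for ins
    using ins emit[of ins q] copy[of ins 2 "addr q + q + 2" end_label] addr_le[of q] q
    by (auto simp: final_def) (auto simp: ok_def A_N_def end_label_def fail_label_def)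
  moreover have "ok ins" if ins: "ins \<in> set (output_const D)" for ins
    using ins by (auto simp: output_const_def intro: load) (auto simp: ok_def)
  ultimately have "\<forall>ins\<in>set (prog M). ok ins" by (auto simp: M_def)
  moreover have "num_idx M = 5" by (simp add: M_def)
  ultimately show ?thesis by (simp add: machines_def stop_label_M ok_def)
qed

section \<open>Correctness of the fragments for one step of the walk\<close>

lemma reaches_emit:
  assumes "code_at (prog M) a (emit l)" "l \<in> {1..q}" "f 3 = 1"
  shows "reaches A_N M (conf a f z) (conf (a + q + 1) f (z(1 := l, f 2 := l)))"
proof -
  have "fold (exec A_N) (emit l) (conf a f z) = conf (a + q + 1) f (z(1 := l, f 2 := l))"
    using assms(2,3) by (simp add: emit_def funpow_exec_ConstI fold_exec_load)
  moreover have "\<forall>i\<in>set (emit l). targets (Det i) = None" by (auto simp: emit_def load_def)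
  ultimately show ?thesis using reaches_straight[of M "conf a f z" "emit l" A_N] assms(1) by simp
qed

lemma reaches_halve:
  assumes code: "code_at (prog M) k (halve k (addr (s0 l)) (addr (s1 l)))" and m: "1 < f 1"
  shows "reaches A_N M (conf k f z)
    (conf (addr (nxt l (f 1))) (f(1 := f 1 div 2, 4 := f 1, 5 := f 1 div 2)) z)"
proof -
  note at = reaches_code[OF code]
  have even: "code_at (prog M) (k + 8) (copy_idx 1 5 (k + 8) (addr (s0 l)))"
    and odd: "code_at (prog M) (k + 12) (copy_idx 1 5 (k + 12) (addr (s1 l)))"
    using code_at_append(1)[OF code_at_append(2)[OF code[unfolded halve_def]]]
      code_at_append(2)[OF code_at_append(2)[OF code[unfolded halve_def]]]
    by (simp_all add: eval_nat_numeral)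
  have copy: "reaches A_N M (conf (if even (g 1) then k + 8 else k + 12) g z)
      (conf (addr (nxt l (g 1))) (g(1 := g 5)) z)" if "1 \<le> g 5" for g
    using reaches_copy_idx[OF even, of g A_N z] reaches_copy_idx[OF odd, of g A_N z] that
    by (simp add: nxt_def)
  \<comment> \<open>Invariant at \<open>k + 2\<close>: \<open>I_4\<close> is the odd number just
    below \<open>2 * I_5\<close> and has not reached \<open>I_1\<close>. A full round raises
    \<open>I_4\<close> by 2 and \<open>I_5\<close> by 1, unless one of the tests finds
    \<open>I_4 = I_1\<close>.\<close>
  have loop: "reaches A_N M (conf (k + 2) g z)
      (conf (if even (g 1) then k + 8 else k + 12) (g(4 := g 1, 5 := g 1 div 2)) z)"
    if "g 4 = 2 * g 5 - 1" "1 \<le> g 5" "g 4 < g 1" for g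
    using that
  proof (induction "g 1 - g 4" arbitrary: g rule: less_induct)
    case less
    let ?h = "g(4 := 2 * g 5)" and ?i = "g(4 := 2 * g 5 + 1)"
    have h: "reaches A_N M (conf (k + 2) g z) (conf (k + 3) ?h z)"
      using less.prems by (intro at[where n = 2]) (simp_all add: halve_def)
    show ?case
    proof (cases "g 1 = 2 * g 5")
      case True
      note h
      also have "reaches A_N M (conf (k + 3) ?h z) (conf (k + 8) ?h z)"
        using True by (intro at[where n = 3]) (simp_all add: halve_def)
      finally have "reaches A_N M (conf (k + 2) g z) (conf (k + 8) ?h z)" .
      moreover have eq: "g(4 := g 1, 5 := g 1 div 2) = ?h" using True by auto
      ultimately show ?thesis unfolding eq using True by simp
    next
      case False
      note h
      also have "reaches A_N M (conf (k + 3) ?h z) (conf (k + 4) ?h z)"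
        using False by (intro at[where n = 3]) (simp_all add: halve_def)
      also have "reaches A_N M (conf (k + 4) ?h z) (conf (k + 5) ?i z)"
        by (intro at[where n = 4]) (simp_all add: halve_def)
      finally have i: "reaches A_N M (conf (k + 2) g z) (conf (k + 5) ?i z)" .
      show ?thesis
      proof (cases "g 1 = 2 * g 5 + 1")
        case True
        note i
        also have "reaches A_N M (conf (k + 5) ?i z) (conf (k + 12) ?i z)"
          using True by (intro at[where n = 5]) (simp_all add: halve_def)
        finally have "reaches A_N M (conf (k + 2) g z) (conf (k + 12) ?i z)" .
        moreover have eq: "g(4 := g 1, 5 := g 1 div 2) = ?i" using True by auto
        ultimately show ?thesis unfolding eq using True by simp
      next
        case neq: False
        let ?j = "?i(5 := g 5 + 1)"
        note i
        also have "reaches A_N M (conf (k + 5) ?i z) (conf (k + 6) ?i z)"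
          using neq by (intro at[where n = 5]) (simp_all add: halve_def)
        also have "reaches A_N M (conf (k + 6) ?i z) (conf (k + 7) ?j z)"
          by (intro at[where n = 6]) (simp_all add: halve_def)
        also have "reaches A_N M (conf (k + 7) ?j z) (conf (k + 2) ?j z)"
          by (intro at[where n = 7]) (simp_all add: halve_def)
        also have "reaches A_N M (conf (k + 2) ?j z)
            (conf (if even (?j 1) then k + 8 else k + 12) (?j(4 := ?j 1, 5 := ?j 1 div 2)) z)"
          using less.prems False neq by (intro less.hyps) auto
        finally show ?thesis by (simp add: fun_upd_twist)
      qed
    qed
  qed
  let ?f = "f(4 := 1, 5 := 1)" and ?f' = "f(4 := f 1, 5 := f 1 div 2)"
  have "reaches A_N M (conf k f z) (conf (k + 1) (f(4 := 1)) z)"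
    by (intro at[where n = 0]) (simp_all add: halve_def)
  also have "reaches A_N M (conf (k + 1) (f(4 := 1)) z) (conf (k + 2) ?f z)"
    by (intro at[where n = 1]) (simp_all add: halve_def)
  also have "reaches A_N M (conf (k + 2) ?f z) (conf (if even (f 1) then k + 8 else k + 12) ?f' z)"
    using loop[of ?f] m by (simp add: fun_upd_twist)
  also have "reaches A_N M (conf (if even (f 1) then k + 8 else k + 12) ?f' z)
      (conf (addr (nxt l (f 1))) (?f'(1 := f 1 div 2)) z)"
    using copy[of ?f'] m by simp
  finally show ?thesis by (simp add: fun_upd_twist)
qed

lemma reaches_block:
  fixes f z :: "nat \<Rightarrow> nat"
  assumes l: "l \<in> {1..<q}" and "f 3 = 1" "1 \<le> f 1"
  defines "z' \<equiv> z(1 := l, f 2 := l)" and "f' \<equiv> f(2 := f 2 + 1)"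
  shows "f 1 = 1 \<Longrightarrow> reaches A_N M (conf (addr l) f z) (conf fail_label f' z')"
    and "1 < f 1 \<Longrightarrow> reaches A_N M (conf (addr l) f z)
      (conf (addr (nxt l (f 1))) (f'(1 := f 1 div 2, 4 := f 1, 5 := f 1 div 2)) z')"
proof -
  let ?a = "addr l + q + 1"
  note code = code_at_append[OF code_at_block[OF l, unfolded block_def]]
  have len: "length (emit l) = q + 1" using l by (simp add: length_emit)
  have test: "code_at (prog M) ?a [IdxSuccI 2, IdxEqI 1 3 fail_label (addr l + q + 3)]"
    and halve: "code_at (prog M) (addr l + q + 3) (halve (addr l + q + 3) (addr (s0 l)) (addr (s1 l)))"
    using code_at_append[OF code(2)] by (simp_all add: len eval_nat_numeral)
  note at = reaches_code[OF test]
  have "reaches A_N M (conf (addr l) f z) (conf ?a f z')"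
    unfolding z'_def using code(1) l assms(2) by (intro reaches_emit) auto
  also have "reaches A_N M (conf ?a f z') (conf (?a + 1) f' z')"
    by (rule at[where n = 0]) (simp_all add: f'_def)
  finally have test: "reaches A_N M (conf (addr l) f z) (conf (?a + 1) f' z')" .
  show "reaches A_N M (conf (addr l) f z) (conf fail_label f' z')" if "f 1 = 1"
  proof -
    note test
    also have "reaches A_N M (conf (?a + 1) f' z') (conf fail_label f' z')"
      using that assms(2) by (intro at[where n = 1]) (simp_all add: f'_def)
    finally show ?thesis .
  qed
  show "reaches A_N M (conf (addr l) f z)
      (conf (addr (nxt l (f 1))) (f'(1 := f 1 div 2, 4 := f 1, 5 := f 1 div 2)) z')" if "1 < f 1"
  proof -
    note test
    also have "reaches A_N M (conf (?a + 1) f' z') (conf (addr l + q + 3) f' z')"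
      using that assms(2) by (intro at[where n = 1]) (simp_all add: f'_def)
    also have "reaches A_N M (conf (addr l + q + 3) f' z')
        (conf (addr (nxt l (f' 1))) (f'(1 := f' 1 div 2, 4 := f' 1, 5 := f' 1 div 2)) z')"
      using that by (intro reaches_halve halve) (simp add: f'_def)
    finally show ?thesis by (simp add: f'_def)
  qed
qed

section \<open>Outputs of complete runs\<close>

definition outputs :: "nat config \<Rightarrow> nat list \<Rightarrow> bool" where
  "outputs c ys \<longleftrightarrow> (\<exists>d. reaches A_N M c d \<and> stopped M d \<and> content d = ys)"

lemma outputs_reaches: "reaches A_N M c d \<Longrightarrow> outputs d ys \<Longrightarrow> outputs c ys"
  unfolding outputs_def using reaches_trans by blast

lemma run_outputs: "outputs c ys \<Longrightarrow> run A_N M c = Some ys"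
  unfolding outputs_def using run_reaches by blast

lemma tl_map_upd_1: "tl (map (z(1 := a)) [1..<n]) = tl (map z [1..<n])"
  by (cases "1 < n") (auto simp: upt_conv_Cons)

text \<open>An entry written at position \<open>w\<close> may be counted as a written cell or as the
  head of the remaining list. \<open>tl\<close> hides the scratch value \<open>a\<close>, and for
  \<open>w = 1\<close> the new entry itself.\<close>

lemma tl_map_emit:
  assumes "1 \<le> w"
  shows "tl (map (z(1 := a, w := b)) [1..<w + 1] @ ls) = tl (map z [1..<w] @ b # ls)"
proof (cases "w = 1")
  case False
  then have "[1..<w + 1] = 1 # [2..<w] @ [w]" "[1..<w] = 1 # [2..<w]"
    using assms upt_conv_Cons[of 1 w] by (auto simp: numeral_2_eq_2)
  then show ?thesis by simp
qed simp

lemma outputs_final: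
  assumes "1 \<le> f 2" "f 3 = 1"
  shows "outputs (conf (addr q) f z) (1 # tl (map z [1..<f 2] @ [q]))"
proof -
  let ?a = "addr q + q + 1" and ?z = "z(1 := q, f 2 := q)"
  note code = code_at_append[OF code_at_final[unfolded final_def]]
  have len: "length (emit q) = q + 1" using q by (simp add: length_emit)
  have one: "code_at (prog M) ?a [ConstI 1 1]"
    and copy: "code_at (prog M) (addr q + q + 2) (copy_idx 1 2 (addr q + q + 2) end_label)"
    using code_at_append[OF code(2)] by (simp_all add: len)
  have "reaches A_N M (conf (addr q) f z) (conf ?a f ?z)"
    using code(1) q assms(2) by (intro reaches_emit) auto
  also have "reaches A_N M (conf ?a f ?z) (conf (addr q + q + 2) f (?z(1 := 1)))"
    by (rule reaches_code[OF one, where n = 0]) (simp_all add: A_N_def)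
  also have "reaches A_N M (conf (addr q + q + 2) f (?z(1 := 1)))
      (conf end_label (f(1 := f 2)) (?z(1 := 1)))"
    using assms(1) by (intro reaches_copy_idx copy) auto
  finally have "reaches A_N M (conf (addr q) f z) (conf end_label (f(1 := f 2)) (?z(1 := 1)))" .
  moreover have "content (conf end_label (f(1 := f 2)) (?z(1 := 1))) = 1 # tl (map z [1..<f 2] @ [q])"
  proof -
    have "content (conf end_label (f(1 := f 2)) (?z(1 := 1)))
        = 1 # tl (map (?z(1 := 1)) [1..<f 2 + 1])"
      using assms(1) by (simp add: content_def upt_conv_Cons del: upt_Suc)
    also have "\<dots> = 1 # tl (map ?z [1..<f 2 + 1] @ [])" unfolding tl_map_upd_1 by simp
    also have "\<dots> = 1 # tl (map z [1..<f 2] @ [q])" by (subst tl_map_emit[OF assms(1)]) simp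
    finally show ?thesis .
  qed
  ultimately show ?thesis unfolding outputs_def by (force simp: stopped_def stop_label_M)
qed

text \<open>The induction needs runs entered midway: cells 2 to \<open>I_2 - 1\<close> hold what is
  already written, and \<open>walk\<close> supplies the rest. Halving makes \<open>I_1\<close>
  decrease; the leading 1 is what \<open>final\<close> restores.\<close>

lemma outputs_walk:
  "l \<in> {1..q} \<Longrightarrow> 1 \<le> f 1 \<Longrightarrow> 1 \<le> f 2 \<Longrightarrow> f 3 = 1 \<Longrightarrow> outputs (conf (addr l) f z)
     (case walk l (f 1) of None \<Rightarrow> D | Some ls \<Rightarrow> 1 # tl (map z [1..<f 2] @ ls))"
proof (induction "f 1" arbitrary: l f z rule: less_induct)
  case less
  show ?case
  proof (cases "l = q")
    case True
    then show ?thesis using outputs_final[of f z] less.prems by simp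
  next
    case False
    then have l: "l \<in> {1..<q}" using less.prems by auto
    note block = reaches_block[OF l less.prems(4,2), of z]
    define z' where "z' = z(1 := l, f 2 := l)"
    show ?thesis
    proof (cases "f 1 = 1")
      case True
      obtain d where "reaches A_N M (conf fail_label (f(2 := f 2 + 1)) z') d"
          "lab d = end_label" "content d = D"
        using reaches_output_const[OF code_at_fail D] by (auto simp: end_label_def)
      then have "outputs (conf fail_label (f(2 := f 2 + 1)) z') D"
        by (auto simp: outputs_def stopped_def stop_label_M)
      from outputs_reaches[OF block(1)[OF True] this[unfolded z'_def]] show ?thesis
        using True False by simp
    next
      case m: False
      with less.prems have m: "1 < f 1" by simp
      let ?f = "f(2 := f 2 + 1, 1 := f 1 div 2, 4 := f 1, 5 := f 1 div 2)"
      have "outputs (conf (addr (nxt l (f 1))) ?f z')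
          (case walk (nxt l (f 1)) (?f 1) of None \<Rightarrow> D | Some ls \<Rightarrow> 1 # tl (map z' [1..<?f 2] @ ls))"
        using m l nxt[of l "f 1"] less.prems by (intro less.hyps) auto
      \<comment> \<open>On the left \<open>l\<close> counts among the written cells, on the right it
        is the head of the walk.\<close>
      also have "(case walk (nxt l (f 1)) (?f 1) of None \<Rightarrow> D | Some ls \<Rightarrow> 1 # tl (map z' [1..<?f 2] @ ls))
          = (case walk l (f 1) of None \<Rightarrow> D | Some ls \<Rightarrow> 1 # tl (map z [1..<f 2] @ ls))"
        using m False tl_map_emit[OF less.prems(3), of z l l]
        by (simp add: z'_def del: upt_Suc split: option.split)
      finally show ?thesis
        using outputs_reaches[OF block(2)[OF m]] unfolding z'_def by blast
    qed
  qed
qed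

lemma reaches_prologue:
  assumes "xs \<noteq> []"
  shows "\<exists>f z. reaches A_N M (initial xs) (conf 6 f z) \<and> f 1 = length xs \<and> f 3 = 1 \<and>
    content (conf 6 f z) = replicate (length xs) 1"
proof -
  note at = reaches_code[OF code_at_prologue]
  \<comment> \<open>Invariant: the cells before \<open>I_2\<close> are already 1, and so is the
    source cell \<open>Z_1\<close>. \<open>I_1\<close> must be preserved because the second phase
    takes its digits from it.\<close>
  have loop: "\<exists>f' z'. reaches A_N M (conf 2 f z) (conf 6 f' z') \<and> f' 1 = f 1 \<and> f' 3 = 1 \<and>
      (\<forall>j\<in>{1..f 1}. z' j = 1)"
    if "1 \<le> f 2" "f 2 \<le> f 1" "f 3 = 1" "z 1 = 1" "\<forall>j\<in>{1..<f 2}. z j = 1"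
    for f and z :: "nat \<Rightarrow> nat"
    using that
  proof (induction "f 1 - f 2" arbitrary: f z)
    case 0
    have "reaches A_N M (conf 2 f z) (conf 3 f (z(f 2 := 1)))"
      using 0 by (intro at[where n = 1]) (simp_all add: prologue_def)
    also have "reaches A_N M (conf 3 f (z(f 2 := 1))) (conf 6 f (z(f 2 := 1)))"
      using 0 by (intro at[where n = 2]) (simp_all add: prologue_def)
    finally have "reaches A_N M (conf 2 f z) (conf 6 f (z(f 2 := 1)))" .
    moreover have "\<forall>j\<in>{1..f 1}. (z(f 2 := 1)) j = 1" using 0 by auto
    ultimately show ?case using 0 by blast
  next
    case (Suc n)
    let ?f = "f(2 := f 2 + 1)" and ?z = "z(f 2 := 1)"
    have "reaches A_N M (conf 2 f z) (conf 3 f ?z)"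
      using Suc by (intro at[where n = 1]) (simp_all add: prologue_def)
    also have "reaches A_N M (conf 3 f ?z) (conf 4 f ?z)"
      using Suc(2) by (intro at[where n = 2]) (auto simp: prologue_def)
    also have "reaches A_N M (conf 4 f ?z) (conf 5 ?f ?z)"
      by (intro at[where n = 3]) (simp_all add: prologue_def)
    also have "reaches A_N M (conf 5 ?f ?z) (conf 2 ?f ?z)"
      by (intro at[where n = 4]) (simp_all add: prologue_def)
    finally have "reaches A_N M (conf 2 f z) (conf 2 ?f ?z)" .
    moreover have "\<exists>f' z'. reaches A_N M (conf 2 ?f ?z) (conf 6 f' z') \<and> f' 1 = ?f 1 \<and> f' 3 = 1 \<and>
        (\<forall>j\<in>{1..?f 1}. z' j = 1)"
      using Suc(2-) by (intro Suc.hyps(1)) auto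
    ultimately show ?case using reaches_trans by fastforce
  qed
  define f where "f = (\<lambda>i::nat. if i = 1 then length xs else 1)"
  obtain z where z: "initial xs = conf 1 f z" unfolding initial_def f_def by blast
  have "reaches A_N M (conf 1 f z) (conf 2 f (z(1 := 1)))"
    by (intro at[where n = 0]) (simp_all add: prologue_def A_N_def)
  moreover obtain f' z' where *: "reaches A_N M (conf 2 f (z(1 := 1))) (conf 6 f' z')"
      "f' 1 = length xs" "f' 3 = 1" "\<forall>j\<in>{1..length xs}. z' j = 1"
    using loop[of f "z(1 := 1)"] assms by (auto simp: f_def Suc_le_eq)
  moreover have "content (conf 6 f' z') = replicate (length xs) 1"
    using *(2,4) by (intro replicate_eqI) (auto simp: content_def Suc_le_eq)
  ultimately show ?thesis unfolding z using reaches_trans by blast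
qed

text \<open>After the reset of \<open>I_2\<close> no cell counts as written, and a path from 1 is
  unchanged when its head is replaced by 1.\<close>

lemma outputs_entry:
  assumes "1 \<le> f 1" "f 3 = 1"
  shows "outputs (conf 6 f z) (case walk 1 (f 1) of None \<Rightarrow> D | Some ls \<Rightarrow> ls)"
proof -
  have "1 # tl ls = ls" if "walk 1 (f 1) = Some ls" for ls
    using walk_path_from[OF that] q by (cases ls) (auto simp: path_from_def)
  then have "outputs (conf (addr 1) (f(2 := 1)) z) (case walk 1 (f 1) of None \<Rightarrow> D | Some ls \<Rightarrow> ls)"
    using outputs_walk[of 1 "f(2 := 1)" z] assms q by (simp split: option.splits)
  moreover have "reaches A_N M (conf 6 f z) (conf (addr 1) (f(2 := 1)) z)"
    by (rule reaches_code[OF code_at_prologue, where n = 5]) (simp_all add: prologue_def addr_def)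
  ultimately show ?thesis using outputs_reaches by blast
qed

theorem enumerable_paths:
  assumes "path_from 1 D"
  shows "enumerable A_N 1 {ls. path_from 1 ls}"
proof -
  define g where "g n = (case walk 1 n of None \<Rightarrow> D | Some ls \<Rightarrow> ls)" for n
  have entry: "\<exists>c. reaches A_N M (initial xs) c \<and> lab c = 6 \<and>
      content c = replicate (length xs) 1 \<and> outputs c (g (length xs))" if xs: "xs \<noteq> []" for xs
  proof -
    obtain f z where "reaches A_N M (initial xs) (conf 6 f z)" "f 1 = length xs" "f 3 = 1"
        "content (conf 6 f z) = replicate (length xs) 1"
      using reaches_prologue[OF xs] by blast
    then show ?thesis using outputs_entry[of f z] xs
      by (intro exI[of _ "conf 6 f z"]) (auto simp: g_def Suc_le_eq)
  qed
  have Res: "Res A_N M xs = Some (g (length xs))" if "xs \<noteq> []" for xs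
    using entry[OF that] outputs_reaches run_outputs unfolding Res_def by blast
  have "path_from 1 (g n)" for n
    using walk_path_from[of 1 n] assms q by (auto simp: g_def split: option.splits)
  moreover have "\<exists>us\<in>tuples {1}. g (length us) = ls" if ls: "path_from 1 ls" for ls
  proof -
    obtain m where "1 \<le> m" "walk 1 m = Some ls" using path_from_walk[OF ls] by blast
    then show ?thesis
      by (intro bexI[of _ "replicate m 1"]) (auto simp: g_def tuples_def)
  qed
  ultimately have onto: "(\<lambda>us. g (length us)) ` tuples {1} = {ls. path_from 1 ls}" by auto
  have sub: "{ls. path_from 1 ls} \<subseteq> tuples (universe A_N)"
    by (auto simp: path_from_def tuples_def A_N_def)
  \<comment> \<open>On \<open>xs\<close> and on the tuple of ones of equal length, the second phase
    starts with the same \<open>I_1\<close> and with \<open>I_3 = 1\<close>, and these determine its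
    output.\<close>
  have phases: "\<exists>c. reaches A_N M (initial xs) c \<and> lab c = 6 \<and> content c = replicate (length xs) 1 \<and>
      run A_N M c = Res A_N M (replicate (length xs) 1)" if "xs \<noteq> []" for xs
    using entry[OF that] run_outputs Res[of "replicate (length xs) 1"] that by fastforce
  have one: "1 \<in> universe A_N" by (simp add: A_N_def)
  show ?thesis
    unfolding enumerable_def Let_def
  proof (intro conjI one sub onto exI[of _ "\<lambda>us. g (length us)"] bexI[OF _ M_in_machines] exI[of _ 6] ballI)
    show "Res A_N M us = Some (g (length us))" if "us \<in> tuples {1}" for us
      using that Res by (simp add: tuples_def)
  next
    fix xs assume "xs \<in> tuples (universe A_N)"
    then have "xs \<noteq> []" by (simp add: tuples_def)
    then show "\<exists>c. reaches A_N M (initial xs) c \<and> lab c = 6 \<and> content c = replicate (length xs) 1 \<and>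
        run A_N M c = Res A_N M (replicate (length xs) 1)"
      and "Res A_N M xs = Some (g (length (replicate (length xs) 1)))"
      using phases Res by simp_all
  qed
qed

end

section \<open>Application to the paths of a program\<close>

theorem proposition4p17:
  fixes \<sigma> :: signature and P :: "ninstr list"
  assumes "is_program \<sigma> P"
    and "Lab_fin P \<noteq> {}"
  shows "enumerable A_N 1 (Lab_fin P)"
proof -
  \<comment> \<open>At a non-branching label both digits lead to \<open>beta\<close>, so one digit
    is spent without effect. A path may thus come from several numbers, which surjectivity
    permits.\<close>
  define s0 s1 where "s0 l = (if l \<in> branch_labels P then beta_plus P l else beta P l)"
    and "s1 l = (if l \<in> branch_labels P then beta_minus P l else beta P l)" for l
  obtain D where path: "finite_path P D" using assms(2) by (auto simp: Lab_fin_def)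
  have targets: "l1 \<in> {1..stop_label P} \<and> l2 \<in> {1..stop_label P}"
    if "wf_ninstr \<sigma> (stop_label P) ins" "targets ins = Some (l1, l2)" for ins l1 l2
    using that by (cases ins rule: targets.cases) auto
  have wf: "s0 l \<in> {1..stop_label P} \<and> s1 l \<in> {1..stop_label P}" if l: "1 \<le> l" "l < stop_label P" for l
  proof (cases "l \<in> branch_labels P")
    case True
    moreover have "wf_ninstr \<sigma> (stop_label P) (instr_at P l)"
      using assms(1) l by (auto simp: is_program_def instr_at_def stop_label_def)
    ultimately show ?thesis using targets
      by (auto simp: s0_def s1_def branch_labels_def beta_plus_def beta_minus_def)
  next
    case False
    then show ?thesis using l by (simp add: s0_def s1_def beta_def)
  qed
  interpret walk_machine "stop_label P" s0 s1 D
    using wf path by unfold_locales (auto simp: stop_label_def finite_path_def labels_def)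
  \<comment> \<open>Inner labels are either branching or not, and the case distinction in
    \<open>s0\<close> and \<open>s1\<close> reproduces the two clauses of
    \<open>finite_path\<close>.\<close>
  have "path_from 1 ls \<longleftrightarrow> finite_path P ls" for ls
    unfolding path_from_def finite_path_def successively_conv_nth labels_def inner_labels_def
      nonbranch_labels_def s0_def s1_def by auto
  then show ?thesis using enumerable_paths path by (simp add: Lab_fin_def)
qed

end
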